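(* Let $M$ be a compact $3$-manifold with triangulation $\mathcal{T}$ having $m$ edges. If the solution $l(t)$ of the normalized flow $\dot{l}(t)=-R(l(t))+\lambda(l(t))\,l(t)$, where $\lambda(l)=S(l)/\|l\|^2$, in the space $\mathfrak{M}_l$ of nondegenerate PL-metrics exists for all time $t\ge 0$ and converges as $t\to+\infty$ to a nondegenerate PL-metric $l_\infty\in\mathfrak{M}_l$, then a discrete Einstein metric exists on $(M,\mathcal{T})$; moreover, $l_\infty$ is itself a discrete Einstein metric.
   Context: Let $\mathcal{T}=\{V,E,F,T\}$ be a triangulation (vertices, edges, faces, tetrahedra) of a compact $3$-manifold $M$, with $m=|E|$. A PL-metric is a map $l:E\to(0,+\infty)$ such that, for every tetrahedron $\{i,j,k,l\}\in T$, its six edge lengths are realized by a Euclidean tetrahedron. It is nondegenerate if, for every tetrahedron, all edge lengths are positive, the Euclidean volume (given by the Cayley–Menger formula in the edge lengths) is positive, i.e. the Cayley–Menger determinant is positive, and the triangle inequalities hold in each face. The set of nondegenerate PL-metrics is denoted $\mathfrak{M}_l$ and is an open subset of $\mathbb{R}^m_{>0}$; a metric is written as a column vector $l=(l_1,\dots,l_m)^T$ after ordering the edges, and $\|l\|^2=\sum_{i=1}^m l_i^2$. The combinatorial Ricci curvature at an edge $\{i,j\}$ is $R_{ij}=2\pi-\sum_{\{i,j,k,l\}\in T}\beta_{ij,kl}$, where the sum is over all tetrahedra containing $\{i,j\}$ and $\beta_{ij,kl}$ is the dihedral angle of the Euclidean tetrahedron $\{i,j,k,l\}$ at the edge $\{i,j\}$;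 write $R=R(l)=(R_1,\dots,R_m)^T$ with the same ordering. The total curvature functional is $S(l)=\sum_{i=1}^m R_i l_i$. A metric $l\in\mathfrak{M}_l$ is a discrete Einstein metric if there is a real number $\lambda$ with $R(l)=\lambda l$. *)

theory Defs
  imports "HOL-Analysis.Analysis"
begin

definition topological_manifold :: "nat \<Rightarrow> 'b topology \<Rightarrow> bool" where
  "topological_manifold n M \<longleftrightarrow>
     Hausdorff_space M \<and> second_countable M \<and>
     (\<forall>x\<in>topspace M. \<exists>U W. openin M U \<and> x \<in> U \<and> openin (Euclidean_space n) W \<and>
        subtopology M U homeomorphic_space subtopology (Euclidean_space n) W)"

definition triangulates :: "'a::euclidean_space set set \<Rightarrow> 'b topology \<Rightarrow> bool" where
  "triangulates K M \<longleftrightarrow> simplicial_complex K \<and> top_of_set (\<Union>K) homeomorphic_space M"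

text \<open>
  The \<open>n\<close>-simplices of a complex, each recorded as the set of its \<open>n + 1\<close> vertices, so that an
  edge is literally \<open>{i, j}\<close> and a tetrahedron is \<open>{i, j, k, h}\<close>. The position of the vertices in
  \<open>'a\<close> only serves to describe the combinatorics; PL-metrics do not refer to it.
\<close>

definition simplices :: "nat \<Rightarrow> 'a::euclidean_space set set \<Rightarrow> 'a set set" where
  "simplices n K = {s. card s = n + 1 \<and> \<not> affine_dependent s \<and> convex hull s \<in> K}"

abbreviation edges :: "'a::euclidean_space set set \<Rightarrow> 'a set set" where
  "edges K \<equiv> simplices 1 K"

abbreviation faces :: "'a::euclidean_space set set \<Rightarrow> 'a set set" where
  "faces K \<equiv> simplices 2 K"

abbreviation tetrahedra :: "'a::euclidean_space set set \<Rightarrow> 'a set set" where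
  "tetrahedra K \<equiv> simplices 3 K"

text \<open>
  In what follows, \<open>e\<close> is an ordering of the edges, i.e. a bijection from the finite index type
  \<open>'m\<close> onto \<open>edges K\<close>; a function on the edges is then a vector in \<open>real ^ 'm\<close>.
\<close>

definition edge_length :: "('m::finite \<Rightarrow> 'a set) \<Rightarrow> real ^ 'm \<Rightarrow> 'a \<Rightarrow> 'a \<Rightarrow> real" where
  "edge_length e l i j = l $ the_inv e {i, j}"

definition realizes ::
  "('m::finite \<Rightarrow> 'a set) \<Rightarrow> real ^ 'm \<Rightarrow> 'a set \<Rightarrow> ('a \<Rightarrow> real ^ 3) \<Rightarrow> bool" where
  "realizes e l \<tau> p \<longleftrightarrow>
     (\<forall>i\<in>\<tau>. \<forall>j\<in>\<tau>. i \<noteq> j \<longrightarrow> dist (p i) (p j) = edge_length e l i j)"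

definition pl_metric ::
  "'a::euclidean_space set set \<Rightarrow> ('m::finite \<Rightarrow> 'a set) \<Rightarrow> real ^ 'm \<Rightarrow> bool" where
  "pl_metric K e l \<longleftrightarrow> (\<forall>x. l $ x > 0) \<and> (\<forall>\<tau>\<in>tetrahedra K. \<exists>p. realizes e l \<tau> p)"

text \<open>
  For a Euclidean tetrahedron of volume \<open>V\<close> with edge lengths \<open>d\<close>, the following determinant
  equals \<open>288 V\<^sup>2\<close>. It does not depend on the order of the four vertices.
\<close>

definition cayley_menger :: "('a \<Rightarrow> 'a \<Rightarrow> real) \<Rightarrow> 'a \<Rightarrow> 'a \<Rightarrow> 'a \<Rightarrow> 'a \<Rightarrow> real" where
  "cayley_menger d i j k h = det (vector
     [vector [0, 1, 1, 1, 1],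
      vector [1, 0, (d i j)\<^sup>2, (d i k)\<^sup>2, (d i h)\<^sup>2],
      vector [1, (d i j)\<^sup>2, 0, (d j k)\<^sup>2, (d j h)\<^sup>2],
      vector [1, (d i k)\<^sup>2, (d j k)\<^sup>2, 0, (d k h)\<^sup>2],
      vector [1, (d i h)\<^sup>2, (d j h)\<^sup>2, (d k h)\<^sup>2, 0]] :: real ^ 5 ^ 5)"

definition nondegenerate_pl_metrics ::
  "'a::euclidean_space set set \<Rightarrow> ('m::finite \<Rightarrow> 'a set) \<Rightarrow> (real ^ 'm) set" where
  "nondegenerate_pl_metrics K e =
     {l. pl_metric K e l \<and>
         (\<forall>i j k h. {i, j, k, h} \<in> tetrahedra K \<longrightarrow> cayley_menger (edge_length e l) i j k h > 0) \<and>
         (\<forall>i j k. {i, j, k} \<in> faces K \<longrightarrow>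
            edge_length e l i j < edge_length e l i k + edge_length e l k j)}"

text \<open>
  The dihedral angle at the edge \<open>ab\<close> of the tetrahedron \<open>abcd\<close>: the angle between the
  components of \<open>c - a\<close> and \<open>d - a\<close> orthogonal to the line \<open>ab\<close>.
\<close>

definition orthogonal_part :: "'v::real_inner \<Rightarrow> 'v \<Rightarrow> 'v" where
  "orthogonal_part u w = w - ((w \<bullet> u) / (u \<bullet> u)) *\<^sub>R u"

definition vector_angle :: "'v::real_inner \<Rightarrow> 'v \<Rightarrow> real" where
  "vector_angle v w = arccos ((v \<bullet> w) / (norm v * norm w))"

definition euclidean_dihedral_angle ::
  "real ^ 3 \<Rightarrow> real ^ 3 \<Rightarrow> real ^ 3 \<Rightarrow> real ^ 3 \<Rightarrow> real" where
  "euclidean_dihedral_angle a b c d =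
     vector_angle (orthogonal_part (b - a) (c - a)) (orthogonal_part (b - a) (d - a))"

text \<open>
  For a nondegenerate metric the angle depends neither on the realization \<open>p\<close> (unique up to
  isometry) nor on the naming of the vertices, so the description below is definite.
\<close>

definition dihedral_angle ::
  "('m::finite \<Rightarrow> 'a set) \<Rightarrow> real ^ 'm \<Rightarrow> 'a set \<Rightarrow> 'a set \<Rightarrow> real" where
  "dihedral_angle e l \<tau> \<epsilon> =
     (THE \<beta>. \<exists>p i j k h. realizes e l \<tau> p \<and> \<epsilon> = {i, j} \<and> \<tau> = {i, j, k, h} \<and>
        \<beta> = euclidean_dihedral_angle (p i) (p j) (p k) (p h))"

definition ricci_curvature ::
  "'a::euclidean_space set set \<Rightarrow> ('m::finite \<Rightarrow> 'a set) \<Rightarrow> real ^ 'm \<Rightarrow> real ^ 'm" where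
  "ricci_curvature K e l =
     (\<chi> x. 2 * pi - (\<Sum>\<tau> | \<tau> \<in> tetrahedra K \<and> e x \<subseteq> \<tau>. dihedral_angle e l \<tau> (e x)))"

definition total_curvature ::
  "'a::euclidean_space set set \<Rightarrow> ('m::finite \<Rightarrow> 'a set) \<Rightarrow> real ^ 'm \<Rightarrow> real" where
  "total_curvature K e l = (\<Sum>x\<in>UNIV. ricci_curvature K e l $ x * l $ x)"

definition discrete_einstein_metric ::
  "'a::euclidean_space set set \<Rightarrow> ('m::finite \<Rightarrow> 'a set) \<Rightarrow> real ^ 'm \<Rightarrow> bool" where
  "discrete_einstein_metric K e l \<longleftrightarrow>
     l \<in> nondegenerate_pl_metrics K e \<and> (\<exists>c::real. ricci_curvature K e l = c *\<^sub>R l)"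

definition normalization_factor ::
  "'a::euclidean_space set set \<Rightarrow> ('m::finite \<Rightarrow> 'a set) \<Rightarrow> real ^ 'm \<Rightarrow> real" where
  "normalization_factor K e l = total_curvature K e l / (norm l)\<^sup>2"

definition normalized_flow_solution ::
  "'a::euclidean_space set set \<Rightarrow> ('m::finite \<Rightarrow> 'a set) \<Rightarrow> (real \<Rightarrow> real ^ 'm) \<Rightarrow> bool" where
  "normalized_flow_solution K e l \<longleftrightarrow>
     (\<forall>t\<ge>0. l t \<in> nondegenerate_pl_metrics K e \<and>
        (l has_vector_derivative
           - ricci_curvature K e (l t) + normalization_factor K e (l t) *\<^sub>R l t)
          (at t within {0..}))"

end

theory Submission
  imports Defs
begin

text \<open>
  A trajectory that converges while its velocity converges as well must have limit velocity \<open>0\<close>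
  (\<open>converging_curve_limit_velocity_zero\<close>): otherwise it would drift away linearly. The velocity
  of the normalized flow is the vector field \<open>X l = - R l + \<lambda> l *\<^sub>R l\<close> taken at \<open>l t\<close>, so once
  \<open>X\<close> is known to be continuous on the nondegenerate metrics, \<open>X l_inf = 0\<close>, which is the Einstein equation
  \<open>R l_inf = \<lambda> l_inf *\<^sub>R l_inf\<close>.

  The content is therefore the continuity of the curvature on the nondegenerate metrics, that is,
  of each dihedral angle. An angle is described through some realization of the tetrahedron
  in space, with nothing said about how the realization varies with the metric. Polarization
  removes the realization: the inner products of the edge vectors at a vertex are polynomials in the
  edge lengths, so the cosine of the dihedral angle is an explicit function of the six lengths
  (\<open>dihedral_angle_eq_arccos\<close>). The same computation shows that the angle is well defined. The formula
  is continuous where its denominators do not vanish; these are built from the length of the edge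
  and the heights of two faces over it, which are positive by Heron's formula and the strict triangle
  inequalities (\<open>height_squared_pos\<close>).
\<close>

section \<open>The dihedral angle as a function of the edge lengths\<close>

text \<open>
  By polarization, the inner product of two edge vectors of lengths \<open>x\<close> and \<open>y\<close> leaving the
  same vertex, when their end points have distance \<open>z\<close>.
\<close>

definition gram_entry :: "real \<Rightarrow> real \<Rightarrow> real \<Rightarrow> real" where
  "gram_entry x y z = (x\<^sup>2 + y\<^sup>2 - z\<^sup>2) / 2"

text \<open>The squared height over the side \<open>x\<close> of a triangle with sides \<open>x\<close>, \<open>y\<close>, \<open>z\<close>.\<close>

definition height_squared :: "real \<Rightarrow> real \<Rightarrow> real \<Rightarrow> real" where
  "height_squared x y z = y\<^sup>2 - (gram_entry x y z)\<^sup>2 / x\<^sup>2"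

text \<open>
  Here \<open>x\<close> is the length of the edge carrying the angle, \<open>x, y, z\<close> and \<open>x, y', z'\<close> are the sides
  of the two faces containing it, where \<open>y\<close> and \<open>y'\<close> start at the same vertex, and \<open>w\<close> is the
  length of the opposite edge.
\<close>

definition dihedral_cosine :: "real \<Rightarrow> real \<Rightarrow> real \<Rightarrow> real \<Rightarrow> real \<Rightarrow> real \<Rightarrow> real" where
  "dihedral_cosine x y z y' z' w =
     (gram_entry y y' w - gram_entry x y z * gram_entry x y' z' / x\<^sup>2) /
     (sqrt (height_squared x y z) * sqrt (height_squared x y' z'))"

text \<open>
  Heron's formula: \<open>4 x\<^sup>2\<close> times the squared height is sixteen times the squared area, a
  product whose factors are positive by the triangle inequalities.
\<close>

lemma height_squared_pos:
  assumes "0 < x" "x < y + z" "y < x + z" "z < x + y"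
  shows "0 < height_squared x y z"
proof -
  have "0 < (x + y + z) * (x + y - z) * (x + z - y) * (y + z - x)"
    using assms by (intro mult_pos_pos) auto
  also have "\<dots> = 4 * x\<^sup>2 * height_squared x y z"
    using assms(1) by (simp add: height_squared_def gram_entry_def field_simps power2_eq_square)
  finally show ?thesis
    using assms(1) by (simp add: zero_less_mult_iff)
qed

lemma continuous_on_gram_entry:
  assumes "continuous_on S x" "continuous_on S y" "continuous_on S z"
  shows "continuous_on S (\<lambda>s. gram_entry (x s) (y s) (z s))"
  unfolding gram_entry_def using assms by (intro continuous_intros) auto

lemma continuous_on_height_squared:
  assumes "continuous_on S x" "continuous_on S y" "continuous_on S z" "\<And>s. s \<in> S \<Longrightarrow> x s \<noteq> 0"
  shows "continuous_on S (\<lambda>s. height_squared (x s) (y s) (z s))"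
  unfolding height_squared_def using assms
  by (intro continuous_intros continuous_on_gram_entry) auto

lemma continuous_on_dihedral_cosine:
  assumes "continuous_on S x" "continuous_on S y" "continuous_on S z"
    and "continuous_on S y'" "continuous_on S z'" "continuous_on S w"
    and "\<And>s. s \<in> S \<Longrightarrow> x s \<noteq> 0"
    and "\<And>s. s \<in> S \<Longrightarrow> height_squared (x s) (y s) (z s) \<noteq> 0"
    and "\<And>s. s \<in> S \<Longrightarrow> height_squared (x s) (y' s) (z' s) \<noteq> 0"
  shows "continuous_on S (\<lambda>s. dihedral_cosine (x s) (y s) (z s) (y' s) (z' s) (w s))"
  unfolding dihedral_cosine_def using assms
  by (intro continuous_intros continuous_on_gram_entry continuous_on_height_squared) auto

lemma inner_diff_eq_gram_entry:
  fixes a b c :: "'v::real_inner"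
  shows "(b - a) \<bullet> (c - a) = gram_entry (dist a b) (dist a c) (dist b c)"
  by (simp add: gram_entry_def dist_norm power2_norm_eq_inner inner_diff inner_commute algebra_simps)

lemma inner_orthogonal_part:
  "orthogonal_part u v \<bullet> orthogonal_part u w = v \<bullet> w - (u \<bullet> v) * (u \<bullet> w) / (u \<bullet> u)"
  by (cases "u = 0")
    (simp_all add: orthogonal_part_def inner_diff inner_commute field_simps)

lemma norm_orthogonal_part:
  "norm (orthogonal_part (b - a) (c - a)) = sqrt (height_squared (dist a b) (dist a c) (dist b c))"
proof -
  have "(dist a x)\<^sup>2 = (x - a) \<bullet> (x - a)" for x
    by (simp add: dist_norm power2_norm_eq_inner inner_diff inner_commute)
  then show ?thesis
    unfolding norm_eq_sqrt_inner inner_orthogonal_part height_squared_def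
      inner_diff_eq_gram_entry[symmetric]
    by (simp add: power2_eq_square)
qed

lemma euclidean_dihedral_cosine:
  "(orthogonal_part (b - a) (c - a) \<bullet> orthogonal_part (b - a) (d - a)) /
     (norm (orthogonal_part (b - a) (c - a)) * norm (orthogonal_part (b - a) (d - a))) =
   dihedral_cosine (dist a b) (dist a c) (dist b c) (dist a d) (dist b d) (dist c d)"
proof -
  have "(dist a b)\<^sup>2 = (b - a) \<bullet> (b - a)"
    by (simp add: dist_norm power2_norm_eq_inner inner_diff inner_commute)
  then show ?thesis
    unfolding dihedral_cosine_def norm_orthogonal_part inner_orthogonal_part inner_diff_eq_gram_entry
    by simp
qed

text \<open>
  Outside \<open>[-1, 1]\<close> the function \<open>arccos\<close> is unspecified, so its continuity is of use only together
  with this bound, which is the Cauchy-Schwarz inequality for the two orthogonal components.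
\<close>

lemma dihedral_cosine_bounds:
  fixes a b c d :: "'v::real_inner"
  shows "dihedral_cosine (dist a b) (dist a c) (dist b c) (dist a d) (dist b d) (dist c d) \<in> {-1..1}"
proof -
  have bound: "\<bar>v \<bullet> w / (norm v * norm w)\<bar> \<le> 1" for v w :: 'v
    using Cauchy_Schwarz_ineq2[of v w] by (auto simp: divide_le_eq_1)
  show ?thesis
    using bound[of "orthogonal_part (b - a) (c - a)" "orthogonal_part (b - a) (d - a)"]
    unfolding euclidean_dihedral_cosine by (simp add: abs_le_iff)
qed

lemma euclidean_dihedral_angle_eq_arccos:
  "euclidean_dihedral_angle a b c d =
   arccos (dihedral_cosine (dist a b) (dist a c) (dist b c) (dist a d) (dist b d) (dist c d))"
  by (simp add: euclidean_dihedral_angle_def vector_angle_def euclidean_dihedral_cosine)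

lemma euclidean_dihedral_angle_swap_opposite:
  "euclidean_dihedral_angle a b d c = euclidean_dihedral_angle a b c d"
  by (simp add: euclidean_dihedral_angle_def vector_angle_def inner_commute mult.commute)

text \<open>
  Moving the base point from \<open>a\<close> to \<open>b\<close> changes the vectors to the opposite vertices by a
  multiple of the edge vector, hence leaves their orthogonal components alone.
\<close>

lemma euclidean_dihedral_angle_swap_edge:
  assumes "a \<noteq> b"
  shows "euclidean_dihedral_angle b a c d = euclidean_dihedral_angle a b c d"
proof -
  have "orthogonal_part (a - b) (x - b) = orthogonal_part (b - a) (x - a)" for x
  proof -
    define u where "u = b - a"
    define v where "v = x - a"
    have "u \<noteq> 0" "a - b = - u" "x - b = v - u"
      using assms by (auto simp: u_def v_def)
    moreover from this(1) have "orthogonal_part (- u) (v - u) = orthogonal_part u v"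
      by (simp add: orthogonal_part_def inner_diff_left diff_divide_distrib scaleR_diff_left)
    ultimately show ?thesis by (simp add: u_def v_def)
  qed
  then show ?thesis by (simp add: euclidean_dihedral_angle_def)
qed

section \<open>Continuity of the curvature\<close>

lemma simplices_mono:
  assumes "simplicial_complex K" "s \<in> simplices n K" "r \<subseteq> s" "card r = m + 1"
  shows "r \<in> simplices m K"
proof -
  have "\<not> affine_dependent s" "convex hull s \<in> K"
    using assms(2) by (auto simp: simplices_def)
  moreover from this(1) have "convex hull r face_of convex hull s"
    using assms(3) face_of_convex_hull_affine_independent by blast
  ultimately show ?thesis
    using assms affine_independent_subset[of s r]
    by (auto simp: simplices_def simplicial_complex_def)
qed

lemma edge_length_commute: "edge_length e l i j = edge_length e l j i"
  by (simp add: edge_length_def insert_commute)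

lemma edge_length_pos:
  assumes "l \<in> nondegenerate_pl_metrics K e"
  shows "0 < edge_length e l i j"
  using assms by (simp add: nondegenerate_pl_metrics_def pl_metric_def edge_length_def)

lemma continuous_on_edge_length: "continuous_on S (\<lambda>l. edge_length e l i j)"
  unfolding edge_length_def by (intro continuous_intros)

lemma height_squared_face_pos:
  assumes l: "l \<in> nondegenerate_pl_metrics K e" and face: "{i, j, k} \<in> faces K"
  shows "0 < height_squared (edge_length e l i j) (edge_length e l i k) (edge_length e l j k)"
proof -
  have tri: "edge_length e l a b < edge_length e l a c + edge_length e l c b"
    if "{a, b, c} \<in> faces K" for a b c
    using l that by (simp add: nondegenerate_pl_metrics_def)
  show ?thesis
    using tri[of i j k] tri[of i k j] tri[of j k i] face edge_length_pos[OF l, of i j]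
    by (intro height_squared_pos) (simp_all add: insert_commute edge_length_commute)
qed

abbreviation edge_dihedral_cosine ::
  "('m::finite \<Rightarrow> 'a set) \<Rightarrow> real ^ 'm \<Rightarrow> 'a \<Rightarrow> 'a \<Rightarrow> 'a \<Rightarrow> 'a \<Rightarrow> real" where
  "edge_dihedral_cosine e l i j k h \<equiv>
     dihedral_cosine (edge_length e l i j) (edge_length e l i k) (edge_length e l j k)
       (edge_length e l i h) (edge_length e l j h) (edge_length e l k h)"

lemma card_4_distinct:
  assumes "card {i, j, k, h} = 4"
  shows "distinct [i, j, k, h]"
  using assms card_distinct[of "[i, j, k, h]"] by simp

lemma realizes_dihedral_cosine:
  assumes "realizes e l {i, j, k, h} p" "distinct [i, j, k, h]"
  shows "dihedral_cosine (dist (p i) (p j)) (dist (p i) (p k)) (dist (p j) (p k))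
           (dist (p i) (p h)) (dist (p j) (p h)) (dist (p k) (p h)) = edge_dihedral_cosine e l i j k h"
proof -
  have "dist (p a) (p b) = edge_length e l a b" if "a \<in> {i, j, k, h}" "b \<in> {i, j, k, h}" "a \<noteq> b" for a b
    using assms(1) that by (auto simp: realizes_def)
  then show ?thesis
    using assms(2) by simp
qed

text \<open>
  Any two namings of the vertices compatible with the edge differ by swapping its end points
  and by swapping the two opposite vertices. The Euclidean angle is invariant under both swaps, and
  for a fixed naming the lengths determine it; so all realizations yield one value.
\<close>

lemma dihedral_angle_eq_arccos:
  assumes l: "l \<in> nondegenerate_pl_metrics K e" and tet: "{i, j, k, h} \<in> tetrahedra K"
  shows "dihedral_angle e l {i, j, k, h} {i, j} = arccos (edge_dihedral_cosine e l i j k h)"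
    and "edge_dihedral_cosine e l i j k h \<in> {-1..1}"
proof -
  have "card {i, j, k, h} = 4"
    using tet by (simp add: simplices_def)
  note dist_ijkh = card_4_distinct[OF this]
  obtain p where p: "realizes e l {i, j, k, h} p"
    using l tet by (auto simp: nondegenerate_pl_metrics_def pl_metric_def)
  show "edge_dihedral_cosine e l i j k h \<in> {-1..1}"
    using dihedral_cosine_bounds[of "p i" "p j" "p k" "p h"]
    unfolding realizes_dihedral_cosine[OF p dist_ijkh] .
  have angle: "euclidean_dihedral_angle (q i) (q j) (q k) (q h) =
      arccos (edge_dihedral_cosine e l i j k h)" if "realizes e l {i, j, k, h} q" for q
    unfolding euclidean_dihedral_angle_eq_arccos realizes_dihedral_cosine[OF that dist_ijkh] ..
  show "dihedral_angle e l {i, j, k, h} {i, j} = arccos (edge_dihedral_cosine e l i j k h)"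
    unfolding dihedral_angle_def
  proof (rule the_equality)
    show "\<exists>q i' j' k' h'. realizes e l {i, j, k, h} q \<and> {i, j} = {i', j'} \<and>
        {i, j, k, h} = {i', j', k', h'} \<and>
        arccos (edge_dihedral_cosine e l i j k h) =
          euclidean_dihedral_angle (q i') (q j') (q k') (q h')"
      using p angle[OF p] by metis
  next
    fix \<beta>
    assume "\<exists>q i' j' k' h'. realizes e l {i, j, k, h} q \<and> {i, j} = {i', j'} \<and>
        {i, j, k, h} = {i', j', k', h'} \<and> \<beta> = euclidean_dihedral_angle (q i') (q j') (q k') (q h')"
    then obtain q i' j' k' h' where q: "realizes e l {i, j, k, h} q" and ij: "{i, j} = {i', j'}"
      and ijkh: "{i, j, k, h} = {i', j', k', h'}"
      and \<beta>: "\<beta> = euclidean_dihedral_angle (q i') (q j') (q k') (q h')"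
      by blast
    have "distinct [i', j', k', h']"
      using \<open>card {i, j, k, h} = 4\<close> unfolding ijkh by (rule card_4_distinct)
    then have "{k', h'} = {i', j', k', h'} - {i', j'}"
      by auto
    also have "\<dots> = {k, h}"
      unfolding ij[symmetric] ijkh[symmetric] using dist_ijkh by auto
    finally have kh: "k' = k \<and> h' = h \<or> k' = h \<and> h' = k"
      by (simp add: doubleton_eq_iff)
    have "dist (q i) (q j) = edge_length e l i j"
      using q dist_ijkh by (simp add: realizes_def)
    then have "q i \<noteq> q j"
      using edge_length_pos[OF l, of i j] by auto
    moreover have "i' = i \<and> j' = j \<or> i' = j \<and> j' = i"
      using ij by (auto simp: doubleton_eq_iff)
    ultimately have "\<beta> = euclidean_dihedral_angle (q i) (q j) (q k) (q h)"
      unfolding \<beta> using kh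
      by (metis euclidean_dihedral_angle_swap_edge euclidean_dihedral_angle_swap_opposite)
    then show "\<beta> = arccos (edge_dihedral_cosine e l i j k h)"
      using angle[OF q] by simp
  qed
qed

lemma continuous_on_dihedral_angle:
  assumes K: "simplicial_complex K" and "\<tau> \<in> tetrahedra K" "\<epsilon> \<in> edges K" "\<epsilon> \<subseteq> \<tau>"
  shows "continuous_on (nondegenerate_pl_metrics K e) (\<lambda>l. dihedral_angle e l \<tau> \<epsilon>)"
proof -
  have "card \<epsilon> = 2" "card \<tau> = 4"
    using assms by (auto simp: simplices_def)
  moreover from this have "card (\<tau> - \<epsilon>) = 2"
    using \<open>\<epsilon> \<subseteq> \<tau>\<close> by (simp add: card_Diff_subset card_ge_0_finite)
  ultimately obtain i j k h where ij: "\<epsilon> = {i, j}" and kh: "\<tau> - \<epsilon> = {k, h}"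
    by (metis card_2_iff)
  then have \<tau>: "\<tau> = {i, j, k, h}"
    using \<open>\<epsilon> \<subseteq> \<tau>\<close> by auto
  then have tet: "{i, j, k, h} \<in> tetrahedra K" and "distinct [i, j, k, h]"
    using assms(2) \<open>card \<tau> = 4\<close> card_4_distinct[of i j k h] by auto
  then have faces: "{i, j, k} \<in> faces K" "{i, j, h} \<in> faces K"
    by (auto intro!: simplices_mono[OF K tet])
  let ?N = "nondegenerate_pl_metrics K e"
  have "continuous_on ?N (\<lambda>l. edge_dihedral_cosine e l i j k h)"
    by (intro continuous_on_dihedral_cosine continuous_on_edge_length less_imp_neq[THEN not_sym]
        edge_length_pos height_squared_face_pos) (use faces in simp_all)
  then have "continuous_on ?N (\<lambda>l. arccos (edge_dihedral_cosine e l i j k h))"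
    by (rule continuous_on_arccos) (use dihedral_angle_eq_arccos(2)[OF _ tet] in auto)
  then show ?thesis
    unfolding ij \<tau> by (rule continuous_on_eq) (simp add: dihedral_angle_eq_arccos(1)[OF _ tet])
qed

lemma continuous_on_ricci_curvature:
  assumes "simplicial_complex K" "range e \<subseteq> edges K"
  shows "continuous_on (nondegenerate_pl_metrics K e) (ricci_curvature K e)"
  unfolding ricci_curvature_def
  using assms by (intro continuous_intros continuous_on_dihedral_angle) auto

lemma continuous_on_normalized_flow_field:
  assumes "simplicial_complex K" "range e \<subseteq> edges K"
  shows "continuous_on (nondegenerate_pl_metrics K e)
    (\<lambda>l. - ricci_curvature K e l + normalization_factor K e l *\<^sub>R l)"
proof -
  have "l \<noteq> 0" if "l \<in> nondegenerate_pl_metrics K e" for l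
    using that by (auto simp: nondegenerate_pl_metrics_def pl_metric_def)
  then show ?thesis
    unfolding normalization_factor_def total_curvature_def
    by (intro continuous_intros continuous_on_ricci_curvature assms) auto
qed

section \<open>Convergent trajectories\<close>

text \<open>
  By l'Hopital's rule the limit velocity is the limit of \<open>f t / t\<close>, which is \<open>0\<close> for a convergent
  \<open>f\<close>; apply this to every component.
\<close>

lemma converging_curve_limit_velocity_zero:
  fixes f f' :: "real \<Rightarrow> 'v::euclidean_space"
  assumes deriv: "\<And>t. 0 \<le> t \<Longrightarrow> (f has_vector_derivative f' t) (at t within {0..})"
    and f: "(f \<longlongrightarrow> L) at_top" and f': "(f' \<longlongrightarrow> v) at_top"
  shows "v = 0"
proof (rule euclidean_eqI)
  fix b :: 'v
  have comp: "((\<lambda>t. f t \<bullet> b) has_real_derivative f' t \<bullet> b) (at t)" if "0 < t" for t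
  proof -
    have "(f has_vector_derivative f' t) (at t)"
      using has_vector_derivative_within_subset[OF deriv[of t], of "{0<..}"] that
      by (simp add: at_within_open[of t "{0<..}"] subset_eq)
    then show ?thesis
      unfolding has_real_derivative_iff_has_vector_derivative
      by (rule bounded_linear.has_vector_derivative[OF bounded_linear_inner_left])
  qed
  have "((\<lambda>t. (f t \<bullet> b) / t) \<longlongrightarrow> v \<bullet> b) at_top"
  proof (rule lhospital_at_top_at_top)
    show "\<forall>\<^sub>F t in at_top. ((\<lambda>t. f t \<bullet> b) has_real_derivative f' t \<bullet> b) (at t)"
      using eventually_gt_at_top[of 0] by eventually_elim (rule comp)
    show "\<forall>\<^sub>F t in at_top. ((\<lambda>t. t) has_real_derivative 1) (at t)"
      by simp
    show "((\<lambda>t. (f' t \<bullet> b) / 1) \<longlongrightarrow> v \<bullet> b) at_top"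
      using tendsto_inner[OF f' tendsto_const[of b]] by simp
  qed (simp_all add: filterlim_ident)
  moreover have "((\<lambda>t. (f t \<bullet> b) / t) \<longlongrightarrow> 0) at_top"
    using tendsto_inner[OF f tendsto_const[of b]]
    by (rule tendsto_divide_0) (rule filterlim_mono[OF filterlim_ident at_top_le_at_infinity order_refl])
  ultimately have "v \<bullet> b = 0"
    by (rule tendsto_unique[OF trivial_limit_at_top_linorder])
  then show "v \<bullet> b = 0 \<bullet> b"
    by simp
qed

theorem theorem2p2:
  fixes M :: "'b topology"
    and K :: "'a::euclidean_space set set"
    and e :: "'m::finite \<Rightarrow> 'a set"
    and l :: "real \<Rightarrow> real ^ 'm"
    and l_inf :: "real ^ 'm"
  assumes "compact_space M" and "topological_manifold 3 M"
    and "triangulates K M"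
    and "bij_betw e UNIV (edges K)"
    and "normalized_flow_solution K e l"
    and "(l \<longlongrightarrow> l_inf) at_top"
    and "l_inf \<in> nondegenerate_pl_metrics K e"
  shows "(\<exists>l'. discrete_einstein_metric K e l') \<and> discrete_einstein_metric K e l_inf"
proof -
  let ?X = "\<lambda>l. - ricci_curvature K e l + normalization_factor K e l *\<^sub>R l"
  have "continuous_on (nondegenerate_pl_metrics K e) ?X"
    using assms(3,4)
    by (intro continuous_on_normalized_flow_field) (auto simp: triangulates_def bij_betw_def)
  moreover have "\<forall>\<^sub>F t in at_top. l t \<in> nondegenerate_pl_metrics K e"
    using eventually_ge_at_top[of 0]
    by eventually_elim (use assms(5) in \<open>simp add: normalized_flow_solution_def\<close>)
  ultimately have "((\<lambda>t. ?X (l t)) \<longlongrightarrow> ?X l_inf) at_top"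
    using assms(6,7) continuous_on_tendsto_compose by blast
  then have "?X l_inf = 0"
    using assms(5,6)
    by (intro converging_curve_limit_velocity_zero[of l "\<lambda>t. ?X (l t)"])
      (simp_all add: normalized_flow_solution_def)
  then have "ricci_curvature K e l_inf = normalization_factor K e l_inf *\<^sub>R l_inf"
    by simp
  then have "discrete_einstein_metric K e l_inf"
    using assms(7) by (auto simp: discrete_einstein_metric_def)
  then show ?thesis
    by blast
qed

end
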